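(* For every integer $r\ge 1$, the graph $M_r$ has order $n=2r^2+r$ and $\iota^i(M_r)=r(r-1)+1$. Thus $\iota^i(M_r)=n/2-O(\sqrt{n})$ as $r\to\infty$.
   Context: Graphs are finite and simple. The graph $M_r$ is obtained from the complete graph $K_r$ by attaching $r$ new end-vertices (leaves) to each vertex of $K_r$ and then subdividing each leaf-edge exactly once (so each vertex of $K_r$ has $r$ pendant paths with two new vertices each attached to it). For a set $S$ of vertices of a graph $G$, $N[S]$ denotes $S$ together with all neighbors of vertices of $S$. A set $S\subseteq V(G)$ is an isolating set of $G$ if $G-N[S]$ contains no edge. An independent isolating set is an isolating set that is also an independent set. The independent isolation number $\iota^i(G)$ is the minimum size of an independent isolating set of $G$. *)

theory Defs
  imports
    Complex_Main
    "HOL-Library.Landau_Symbols"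
    "Graph_Theory.Graph_Theory"
begin

text \<open>
  Following \<^theory>\<open>Graph_Theory.Digraph\<close>, a finite simple graph is a symmetric loop-free digraph
  without multiple arcs (locale \<^locale>\<open>graph\<close>): an edge is a pair of opposite arcs.
\<close>

section \<open>Independent isolation\<close>

definition closed_nbhd :: "('a,'b) pre_digraph \<Rightarrow> 'a set \<Rightarrow> 'a set" where
  "closed_nbhd G S = S \<union> {v. \<exists>u\<in>S. u \<rightarrow>\<^bsub>G\<^esub> v}"

definition isolating_set :: "('a,'b) pre_digraph \<Rightarrow> 'a set \<Rightarrow> bool" where
  "isolating_set G S \<longleftrightarrow> S \<subseteq> verts G \<and> arcs (G \<restriction> (verts G - closed_nbhd G S)) = {}"

definition independent_set :: "('a,'b) pre_digraph \<Rightarrow> 'a set \<Rightarrow> bool" where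
  "independent_set G S \<longleftrightarrow> S \<subseteq> verts G \<and> (\<forall>u\<in>S. \<forall>v\<in>S. \<not> u \<rightarrow>\<^bsub>G\<^esub> v)"

definition independent_isolating_set :: "('a,'b) pre_digraph \<Rightarrow> 'a set \<Rightarrow> bool" where
  "independent_isolating_set G S \<longleftrightarrow> isolating_set G S \<and> independent_set G S"

text \<open>Only meaningful for finite graphs, where the minimum is over a finite nonempty set;
  see \<open>ex_independent_isolating_set\<close>.\<close>

definition independent_isolation_number :: "('a,'b) pre_digraph \<Rightarrow> nat" where
  "independent_isolation_number G = Min (card ` {S. independent_isolating_set G S})"

lemma (in graph) ex_independent_isolating_set: "\<exists>S. independent_isolating_set G S"
proof -
  have "finite {S. independent_set G S}"
    by (rule finite_subset[of _ "Pow (verts G)"]) (auto simp: independent_set_def)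
  moreover have "independent_set G {}" by (simp add: independent_set_def)
  ultimately obtain S where S: "independent_set G S"
    and max: "\<And>T. independent_set G T \<Longrightarrow> S \<subseteq> T \<Longrightarrow> S = T"
    using finite_has_maximal[of "{S. independent_set G S}"] by blast
  have "v \<in> closed_nbhd G S" if v: "v \<in> verts G" for v
  proof (rule ccontr)
    assume n: "v \<notin> closed_nbhd G S"
    then have "\<not> u \<rightarrow>\<^bsub>G\<^esub> v" "\<not> v \<rightarrow>\<^bsub>G\<^esub> u" if "u \<in> S" for u
      using that arcs_ends_symmetric[OF sym_arcs] by (auto simp: closed_nbhd_def)
    then have "independent_set G (insert v S)"
      using S v adj_not_same by (auto simp: independent_set_def)
    with max have "v \<in> S" by blast
    with n show False by (simp add: closed_nbhd_def)
  qed
  then have empty: "verts G - closed_nbhd G S = {}" by blast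
  have "arcs (G \<restriction> (verts G - closed_nbhd G S)) = {}" unfolding empty by simp
  with S have "independent_isolating_set G S"
    unfolding independent_isolating_set_def isolating_set_def independent_set_def by blast
  then show ?thesis ..
qed

section \<open>The graphs \<open>M\<^sub>r\<close>\<close>

text \<open>\<open>Leaf i j\<close> is the \<open>j\<close>-th end-vertex attached to \<open>Core i\<close>, and \<open>Mid i j\<close> is the vertex that
  subdivides the edge between them.\<close>

datatype m_vertex = Core nat | Mid nat nat | Leaf nat nat

definition core_clique :: "nat \<Rightarrow> m_vertex pair_pre_digraph" where
  "core_clique r = \<lparr> pverts = Core ` {..<r}, parcs = {(Core i, Core j) | i j. i < r \<and> j < r \<and> i \<noteq> j} \<rparr>"

definition attach_leaves :: "nat \<Rightarrow> m_vertex pair_pre_digraph \<Rightarrow> m_vertex pair_pre_digraph" where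
  "attach_leaves r G = \<lparr>
     pverts = pverts G \<union> {Leaf i j | i j. Core i \<in> pverts G \<and> j < r},
     parcs = parcs G \<union> {(Core i, Leaf i j) | i j. Core i \<in> pverts G \<and> j < r}
                     \<union> {(Leaf i j, Core i) | i j. Core i \<in> pverts G \<and> j < r} \<rparr>"

definition M_graph :: "nat \<Rightarrow> m_vertex pair_pre_digraph" where
  "M_graph r = fold (\<lambda>(i, j) G. subdivide G (Core i, Leaf i j) (Mid i j))
     (List.product [0..<r] [0..<r]) (attach_leaves r (core_clique r))"

lemma complete_core_clique: "K\<^bsub>r\<^esub> (with_proj (core_clique r))"
  unfolding complete_digraph_pair_def
  by (auto simp: core_clique_def card_image inj_on_def)

lemma pair_graph_attach_leaves: "pair_graph (attach_leaves r (core_clique r))"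
proof -
  let ?G = "attach_leaves r (core_clique r)"
  have V: "pverts ?G = Core ` {..<r} \<union> (\<lambda>(i, j). Leaf i j) ` ({..<r} \<times> {..<r})"
    by (auto simp: attach_leaves_def core_clique_def)
  have A: "parcs ?G \<subseteq> pverts ?G \<times> pverts ?G"
    by (auto simp: attach_leaves_def core_clique_def)
  have "finite (pverts ?G)" unfolding V by simp
  moreover from this A have "finite (parcs ?G)"
    by (meson finite_SigmaI finite_subset)
  moreover have "sym (parcs ?G)"
    by (rule symI) (auto simp: attach_leaves_def core_clique_def)
  moreover have "(u, v) \<in> parcs ?G \<Longrightarrow> u \<noteq> v" for u v
    by (auto simp: attach_leaves_def core_clique_def)
  ultimately show ?thesis
    using A by unfold_locales (auto simp: symmetric_def)
qed

lemma fold_subdivide: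
  fixes G :: "m_vertex pair_pre_digraph"
  assumes "distinct xs" "pair_graph G"
    and "\<forall>(i, j)\<in>set xs. (Core i, Leaf i j) \<in> parcs G \<and> Mid i j \<notin> pverts G"
  defines "H \<equiv> fold (\<lambda>(i, j) G. subdivide G (Core i, Leaf i j) (Mid i j)) xs G"
  shows "pair_graph H"
    and "pverts H = pverts G \<union> {Mid i j | i j. (i, j) \<in> set xs}"
    and "parcs H = parcs G
           - (\<Union>(i, j)\<in>set xs. {(Core i, Leaf i j), (Leaf i j, Core i)})
           \<union> (\<Union>(i, j)\<in>set xs. {(Core i, Mid i j), (Mid i j, Core i), (Mid i j, Leaf i j), (Leaf i j, Mid i j)})"
  using assms(1-3) unfolding H_def
proof (induction xs arbitrary: G)
  case Nil
  { case 1 then show ?case by simp }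
  { case 2 then show ?case by simp }
  { case 3 then show ?case by simp }
next
  case (Cons x xs)
  obtain i j where x: "x = (i, j)" by (cases x)
  let ?S = "\<lambda>G. subdivide G (Core i, Leaf i j) (Mid i j)"
  have step: "pair_graph (?S G)" "distinct xs"
    "\<forall>(a, b)\<in>set xs. (Core a, Leaf a b) \<in> parcs (?S G) \<and> Mid a b \<notin> pverts (?S G)"
    if "distinct (x # xs)" "pair_graph G"
      "\<forall>(a, b)\<in>set (x # xs). (Core a, Leaf a b) \<in> parcs G \<and> Mid a b \<notin> pverts G" for G
  proof -
    note H = that(3)
    show "pair_graph (?S G)"
      using that(3) x by (intro pair_graph.pair_graph_subdivide that(2)) auto
    show "distinct xs" using that(1) by simp
    have "(Core a, Leaf a b) \<in> parcs (?S G) \<and> Mid a b \<notin> pverts (?S G)" if ab: "(a, b) \<in> set xs" for a b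
    proof -
      have "(a, b) \<noteq> (i, j)" using ab \<open>distinct (x # xs)\<close> x by auto
      moreover have "(Core a, Leaf a b) \<in> parcs G \<and> Mid a b \<notin> pverts G" using ab H by auto
      ultimately show ?thesis by (simp add: subdivide.simps)
    qed
    then show "\<forall>(a, b)\<in>set xs. (Core a, Leaf a b) \<in> parcs (?S G) \<and> Mid a b \<notin> pverts (?S G)"
      by blast
  qed
  { case 1
    note s = step[OF 1]
    show ?case using Cons.IH(1)[OF s(2,1,3)] x by simp }
  { case 2
    note s = step[OF 2]
    show ?case using Cons.IH(2)[OF s(2,1,3)] x by auto }
  { case 3
    note s = step[OF 3]
    let ?old = "\<lambda>xs. \<Union>(i, j)\<in>set xs. {(Core i, Leaf i j), (Leaf i j, Core i)}"
    let ?new = "\<lambda>xs. \<Union>(i, j)\<in>set xs.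
      {(Core i, Mid i j), (Mid i j, Core i), (Mid i j, Leaf i j), (Leaf i j, Mid i j)}"
    have set_eq: "A - O1 \<union> N1 - O2 \<union> N2 = A - (O1 \<union> O2) \<union> (N1 \<union> N2)"
      if "N1 \<inter> O2 = {}" for A N1 N2 O1 O2 :: "m_vertex rel"
      using that by blast
    have disj: "?new [x] \<inter> ?old xs = {}" by (auto simp: x)
    have G: "parcs (?S G) = parcs G - ?old [x] \<union> ?new [x]" by (simp add: x)
    have un: "?old (x # xs) = ?old [x] \<union> ?old xs" "?new (x # xs) = ?new [x] \<union> ?new xs"
      by simp_all
    have "parcs (fold (\<lambda>(i, j) G. subdivide G (Core i, Leaf i j) (Mid i j)) (x # xs) G)
        = parcs (?S G) - ?old xs \<union> ?new xs"
      using Cons.IH(3)[OF s(2,1,3)] by (simp only: fold_simps o_apply x prod.case)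
    also have "\<dots> = parcs G - ?old (x # xs) \<union> ?new (x # xs)"
      unfolding G un using set_eq[OF disj] .
    finally show ?case . }
qed

lemma M_graph:
  shows pair_graph_M_graph: "pair_graph (M_graph r)"
    and pverts_M_graph: "pverts (M_graph r) =
      Core ` {..<r} \<union> {Mid i j | i j. i < r \<and> j < r} \<union> {Leaf i j | i j. i < r \<and> j < r}"
    and parcs_M_graph: "parcs (M_graph r) =
      {(Core i, Core j) | i j. i < r \<and> j < r \<and> i \<noteq> j}
      \<union> (\<Union>i<r. \<Union>j<r. {(Core i, Mid i j), (Mid i j, Core i), (Mid i j, Leaf i j), (Leaf i j, Mid i j)})"
proof -
  let ?xs = "List.product [0..<r] [0..<r]"
  let ?G = "attach_leaves r (core_clique r)"
  have d: "distinct ?xs" by (simp add: distinct_product)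
  have a: "\<forall>(i, j)\<in>set ?xs. (Core i, Leaf i j) \<in> parcs ?G \<and> Mid i j \<notin> pverts ?G"
    by (auto simp: attach_leaves_def core_clique_def)
  note * = fold_subdivide[OF d pair_graph_attach_leaves a, folded M_graph_def]
  show "pair_graph (M_graph r)" using *(1) by blast
  show "pverts (M_graph r) =
      Core ` {..<r} \<union> {Mid i j | i j. i < r \<and> j < r} \<union> {Leaf i j | i j. i < r \<and> j < r}"
    using *(2) by (auto simp: attach_leaves_def core_clique_def)
  have "parcs ?G - (\<Union>(i, j)\<in>set ?xs. {(Core i, Leaf i j), (Leaf i j, Core i)})
      = {(Core i, Core j) | i j. i < r \<and> j < r \<and> i \<noteq> j}"
    by (auto simp: attach_leaves_def core_clique_def)
  moreover have "(\<Union>(i, j)\<in>set ?xs. {(Core i, Mid i j), (Mid i j, Core i), (Mid i j, Leaf i j), (Leaf i j, Mid i j)})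
      = (\<Union>i<r. \<Union>j<r. {(Core i, Mid i j), (Mid i j, Core i), (Mid i j, Leaf i j), (Leaf i j, Mid i j)})"
    by auto
  ultimately show "parcs (M_graph r) =
      {(Core i, Core j) | i j. i < r \<and> j < r \<and> i \<noteq> j}
      \<union> (\<Union>i<r. \<Union>j<r. {(Core i, Mid i j), (Mid i j, Core i), (Mid i j, Leaf i j), (Leaf i j, Mid i j)})"
    using *(3) by (simp only:)
qed

end

theory Submission
  imports Defs
begin

text \<open>
  The \<open>r\<^sup>2\<close> end-edges \<open>Mid i j\<close> -- \<open>Leaf i j\<close> are pairwise disjoint, and an isolating set \<open>S\<close> must
  dominate an end of each of them. If \<open>S\<close> avoids \<open>Core i\<close>, then every one of the \<open>r\<close> end-edges
  hanging from \<open>Core i\<close> contains a vertex of \<open>S\<close>, because \<open>Core i\<close> is its only outside neighbour.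
  A core vertex in \<open>S\<close> is thus worth up to \<open>r\<close> other vertices, but the core is a clique, so
  independence admits at most one. With \<open>c \<le> 1\<close> core vertices, \<open>S\<close> has at least \<open>c + (r - c) * r\<close>
  vertices, which is at least \<open>r * (r - 1) + 1\<close> for \<open>r \<ge> 1\<close>
  (\<open>card_independent_isolating_set_M_graph\<close>). One core vertex together with all subdivision
  vertices around the other core vertices attains this bound
  (\<open>ex_small_independent_isolating_set_M_graph\<close>).

  Since the order is \<open>2 * r\<^sup>2 + r\<close>, the isolation number falls short of half the order by
  \<open>3 * r / 2 - 1\<close>, while \<open>r\<close> is at most the square root of the order.
\<close>

lemma card_verts_M_graph: "card (verts (M_graph r)) = 2 * r ^ 2 + r"
proof -
  let ?I = "{..<r} \<times> {..<r}"
  let ?M = "case_prod Mid ` ?I" and ?L = "case_prod Leaf ` ?I"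
  have "verts (M_graph r) = Core ` {..<r} \<union> (?M \<union> ?L)"
    by (auto simp: pverts_M_graph)
  moreover have "card (Core ` {..<r}) = r" "card ?M = r * r" "card ?L = r * r"
    by (simp_all add: card_image inj_on_def)
  moreover have "card (Core ` {..<r} \<union> (?M \<union> ?L))
      = card (Core ` {..<r}) + (card ?M + card ?L)"
    by (subst card_Un_disjoint; (subst card_Un_disjoint)?) auto
  ultimately show ?thesis
    by (simp add: power2_eq_square)
qed

lemma finite_verts_M_graph: "finite (verts (M_graph r))"
proof -
  interpret pair_graph "M_graph r"
    by (rule pair_graph_M_graph)
  show ?thesis
    by simp
qed

lemma independent_isolating_set_pair_iff:
  fixes G :: "'a pair_pre_digraph"
  shows "independent_isolating_set (with_proj G) S \<longleftrightarrow>
    S \<subseteq> pverts G \<and> (\<forall>u\<in>S. \<forall>v\<in>S. (u, v) \<notin> parcs G) \<and>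
    (\<forall>(u, v)\<in>parcs G. u \<in> pverts G \<and> v \<in> pverts G \<longrightarrow>
       (\<exists>w\<in>S. w = u \<or> w = v \<or> (w, u) \<in> parcs G \<or> (w, v) \<in> parcs G))"
  unfolding independent_isolating_set_def isolating_set_def independent_set_def closed_nbhd_def
  by (auto simp: induce_subgraph_def) blast+

lemma card_independent_isolating_set_M_graph:
  assumes r: "r \<ge> 1" and S: "independent_isolating_set (M_graph r) S"
  shows "r * (r - 1) + 1 \<le> card S"
proof -
  define C where "C = {i. i < r \<and> Core i \<in> S}"
  define B where "B = ({..<r} - C) \<times> {..<r}"
  define f where "f = (\<lambda>(i, j). if Mid i j \<in> S then Mid i j else Leaf i j)"
  have SV: "S \<subseteq> verts (M_graph r)"
    and ind: "\<And>u v. u \<in> S \<Longrightarrow> v \<in> S \<Longrightarrow> (u, v) \<notin> parcs (M_graph r)"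
    and iso: "\<And>u v. (u, v) \<in> parcs (M_graph r) \<Longrightarrow> u \<in> verts (M_graph r) \<Longrightarrow>
        v \<in> verts (M_graph r) \<Longrightarrow>
        \<exists>w\<in>S. w = u \<or> w = v \<or> (w, u) \<in> parcs (M_graph r) \<or> (w, v) \<in> parcs (M_graph r)"
    using S unfolding independent_isolating_set_pair_iff by auto
  have finS: "finite S"
    using SV finite_verts_M_graph by (rule finite_subset)
  have finC: "finite C" and C_sub: "C \<subseteq> {..<r}"
    by (auto simp: C_def)
  have "f p \<in> S" if p: "p \<in> B" for p
  proof -
    obtain i j where ij: "p = (i, j)" "i < r" "j < r" "Core i \<notin> S"
      using p by (auto simp: B_def C_def)
    have "\<exists>w\<in>S. w = Mid i j \<or> w = Leaf i j \<or> (w, Mid i j) \<in> parcs (M_graph r)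
        \<or> (w, Leaf i j) \<in> parcs (M_graph r)"
      using ij by (intro iso) (auto simp: parcs_M_graph pverts_M_graph)
    then have "Mid i j \<in> S \<or> Leaf i j \<in> S"
      using ij by (auto simp: parcs_M_graph)
    then show ?thesis
      by (auto simp: f_def ij)
  qed
  then have "Core ` C \<union> f ` B \<subseteq> S"
    by (auto simp: C_def)
  then have "card (Core ` C \<union> f ` B) \<le> card S"
    by (rule card_mono[OF finS])
  moreover have "card (Core ` C \<union> f ` B) = card (Core ` C) + card (f ` B)"
    using finC by (intro card_Un_disjoint) (auto simp: f_def B_def split: if_splits)
  moreover have "card (Core ` C) = card C"
    by (simp add: card_image inj_on_def)
  moreover have "card (f ` B) = card B"
    by (intro card_image inj_onI) (auto simp: f_def split: if_splits)
  moreover have "card B = (r - card C) * r"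
    using finC C_sub by (simp add: B_def card_Diff_subset)
  ultimately have bound: "card C + (r - card C) * r \<le> card S"
    by simp
  have "i = k" if "i \<in> C" "k \<in> C" for i k
    using that ind[of "Core i" "Core k"] by (auto simp: C_def parcs_M_graph)
  then have "card C \<le> 1"
    by (auto simp: card_le_Suc0_iff_eq[OF finC])
  then consider "card C = 0" | "card C = 1"
    by linarith
  then show ?thesis
  proof cases
    case 1
    have "r * (r - 1) + 1 \<le> r * r"
      using r by (cases r) auto
    with 1 bound show ?thesis
      by simp
  next
    case 2
    with bound show ?thesis
      by (simp add: mult.commute)
  qed
qed

text \<open>The only vertices that the witness fails to dominate are the end-vertices of the paths at the
  chosen core vertex, and these are pairwise non-adjacent.\<close>

lemma ex_small_independent_isolating_set_M_graph:
  assumes r: "r \<ge> 1"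
  shows "\<exists>S. independent_isolating_set (M_graph r) S \<and> card S = r * (r - 1) + 1"
proof (intro exI conjI)
  let ?I = "{1..<r} \<times> {..<r}"
  let ?S = "insert (Core 0) (case_prod Mid ` ?I)"
  have dom: "\<exists>w\<in>?S. w = u \<or> w = v \<or> (w, u) \<in> parcs (M_graph r) \<or> (w, v) \<in> parcs (M_graph r)"
    if uv: "(u, v) \<in> parcs (M_graph r)" for u v
  proof -
    \<comment> \<open>Every edge has an end in the core or among the subdivision vertices, and all of these are
      dominated.\<close>
    have "\<exists>x\<in>{u, v}. (\<exists>i<r. x = Core i) \<or> (\<exists>i<r. \<exists>j<r. x = Mid i j)"
      using uv unfolding parcs_M_graph by blast
    then obtain x where x: "x \<in> {u, v}" "(\<exists>i<r. x = Core i) \<or> (\<exists>i<r. \<exists>j<r. x = Mid i j)"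
      by blast
    have "\<exists>w\<in>?S. w = x \<or> (w, x) \<in> parcs (M_graph r)"
      using x(2)
    proof (elim disjE exE conjE)
      fix i assume "i < r" "x = Core i"
      then show ?thesis
        using r by (cases "i = 0") (auto simp: parcs_M_graph)
    next
      fix i j assume "i < r" "j < r" "x = Mid i j"
      then show ?thesis
        using r by (cases "i = 0") (auto simp: parcs_M_graph image_iff)
    qed
    then show ?thesis
      using x(1) by blast
  qed
  show "independent_isolating_set (M_graph r) ?S"
    unfolding independent_isolating_set_pair_iff
  proof (intro conjI)
    show "?S \<subseteq> pverts (M_graph r)"
      using r by (auto simp: pverts_M_graph)
    show "\<forall>u\<in>?S. \<forall>v\<in>?S. (u, v) \<notin> parcs (M_graph r)"
      by (auto simp: parcs_M_graph)
    show "\<forall>(u, v)\<in>parcs (M_graph r). u \<in> pverts (M_graph r) \<and> v \<in> pverts (M_graph r) \<longrightarrow>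
       (\<exists>w\<in>?S. w = u \<or> w = v \<or> (w, u) \<in> parcs (M_graph r) \<or> (w, v) \<in> parcs (M_graph r))"
      using dom by fast
  qed
  have "card (case_prod Mid ` ?I) = (r - 1) * r"
    by (subst card_image) (auto simp: inj_on_def)
  moreover have "Core 0 \<notin> case_prod Mid ` ?I"
    by auto
  ultimately show "card ?S = r * (r - 1) + 1"
    by (simp add: mult.commute)
qed

lemma independent_isolation_number_M_graph:
  assumes "r \<ge> 1"
  shows "independent_isolation_number (M_graph r) = r * (r - 1) + 1"
  unfolding independent_isolation_number_def
proof (rule Min_eqI)
  have "{S. independent_isolating_set (M_graph r) S} \<subseteq> Pow (verts (M_graph r))"
    by (auto simp: independent_isolating_set_def isolating_set_def)
  then show "finite (card ` {S. independent_isolating_set (M_graph r) S})"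
    using finite_verts_M_graph finite_subset by blast
next
  fix k assume "k \<in> card ` {S. independent_isolating_set (M_graph r) S}"
  then show "r * (r - 1) + 1 \<le> k"
    using card_independent_isolating_set_M_graph[OF assms] by blast
next
  show "r * (r - 1) + 1 \<in> card ` {S. independent_isolating_set (M_graph r) S}"
    using ex_small_independent_isolating_set_M_graph[OF assms] by force
qed

theorem mainTheorem6:
  shows "(\<forall>r\<ge>1. card (verts (M_graph r)) = 2 * r ^ 2 + r
            \<and> independent_isolation_number (M_graph r) = r * (r - 1) + 1)
       \<and> (\<lambda>r. real (card (verts (M_graph r))) / 2 - real (independent_isolation_number (M_graph r)))
           \<in> O[at_top](\<lambda>r. sqrt (real (card (verts (M_graph r)))))"
proof (intro conjI allI impI)
  fix r :: nat assume r: "1 \<le> r"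
  show "card (verts (M_graph r)) = 2 * r ^ 2 + r"
    by (rule card_verts_M_graph)
  show "independent_isolation_number (M_graph r) = r * (r - 1) + 1"
    by (rule independent_isolation_number_M_graph[OF r])
next
  show "(\<lambda>r. real (card (verts (M_graph r))) / 2 - real (independent_isolation_number (M_graph r)))
           \<in> O[at_top](\<lambda>r. sqrt (real (card (verts (M_graph r)))))"
  proof (rule bigoI)
    show "\<forall>\<^sub>F r in at_top.
        norm (real (card (verts (M_graph r))) / 2 - real (independent_isolation_number (M_graph r)))
        \<le> 3 / 2 * norm (sqrt (real (card (verts (M_graph r)))))"
      using eventually_ge_at_top[of 1]
    proof eventually_elim
      case (elim r)
      have "real (card (verts (M_graph r))) / 2 - real (independent_isolation_number (M_graph r))
          = 3 / 2 * real r - 1"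
        using elim unfolding card_verts_M_graph independent_isolation_number_M_graph[OF elim]
        by (simp add: of_nat_diff field_simps power2_eq_square)
      moreover have "real r \<le> sqrt (real (card (verts (M_graph r))))"
        unfolding card_verts_M_graph by (rule real_le_rsqrt) simp
      ultimately show ?case
        using elim by simp
    qed
  qed
qed

end
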